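(* Let $\mathcal N_\tau\ge2$ be an integer. At the $n$-th time step ($2\le n\le N_T$), the length $\mathcal M_n$ of the storage vector $\mathbf U^n$ (equivalently, the number of subintervals used by the FAOM algorithm) satisfies $$(\mathcal N_\tau-1)\big(\log_{\mathcal N_\tau} n-1\big)\le \mathcal M_n\le 2(\mathcal N_\tau-1)\log_{\mathcal N_\tau}\Big(\frac{n+1}{2}\Big).$$
   Context: Grid: $T>0$, $N_T\in\mathbb N$, $h=T/N_T$, $t_n=nh$ for $n=0,\dots,N_T$. Subintervals at time step $n$: fix an integer $\mathcal N_\tau\ge2$. Finite decreasing lists $\mathbf I^n=[I^n_1,\dots,I^n_{\mathcal M_n}]$ (the left endpoints of subintervals) are defined recursively; $\mathbf I^1$ is the empty list. For $n=2,3,\dots,N_T$: (1) let $\tilde{\mathbf I}^n$ be obtained by prepending $t_{n-2}$ to $\mathbf I^{n-1}$, and set $\tilde I^n_0=t_{n-1}$. (2) As long as there is an index $i_0\ge0$ for which the $2\mathcal N_\tau-1$ consecutive gaps $\tilde I^n_{i_0}-\tilde I^n_{i_0+1}=\cdots=\tilde I^n_{i_0+2\mathcal N_\tau-2}-\tilde I^n_{i_0+2\mathcal N_\tau-1}$ are all equal, delete the entries with indices $i_0+\mathcal N_\tau,\dots,i_0+2\mathcal N_\tau-2$ from the list (i.e. merge the $\mathcal N_\tau$ leftmost of these subintervals into one) and re-index. (3) The final list is $\mathbf I^n$, with length $\mathcal M_n$, and $I^n_0=t_{n-1}$. The storage vector $\mathbf U^n$ has exactly one entry per subinterval $[I^n_i,I^n_{i-1}]$,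 $1\le i\le\mathcal M_n$, so its length is $\mathcal M_n$. *)

theory Defs
  imports Complex_Main
begin

definition grid_point :: "real \<Rightarrow> nat \<Rightarrow> nat \<Rightarrow> real" where
  "grid_point T NT n = real n * (T / real NT)"

text \<open>In the next three definitions the list \<open>xs\<close> is the working list including its entry of
  index 0 (the current time), so that \<open>xs ! i\<close> is the entry with index \<open>i\<close>.\<close>

definition mergeable :: "nat \<Rightarrow> real list \<Rightarrow> nat \<Rightarrow> bool" where
  "mergeable N xs i \<longleftrightarrow> i + 2 * N - 1 < length xs \<and>
     (\<forall>j < 2 * N - 1. xs ! (i + j) - xs ! (i + j + 1) = xs ! i - xs ! (i + 1))"

text \<open>Removes exactly the entries with indices \<open>i + N, \<dots>, i + 2 * N - 2\<close>.\<close>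

definition merge_at :: "nat \<Rightarrow> nat \<Rightarrow> real list \<Rightarrow> real list" where
  "merge_at N i xs = take (i + N) xs @ drop (i + 2 * N - 1) xs"

definition merge_step :: "nat \<Rightarrow> real list \<Rightarrow> real list \<Rightarrow> bool" where
  "merge_step N xs ys \<longleftrightarrow> (\<exists>i. mergeable N xs i \<and> ys = merge_at N i xs)"

text \<open>The merging loop does not prescribe which admissible index is used in a pass; hence the loop
  is a relation between its input and any possible output.\<close>

definition merge_loop :: "nat \<Rightarrow> real list \<Rightarrow> real list \<Rightarrow> bool" where
  "merge_loop N xs ys \<longleftrightarrow> (merge_step N)\<^sup>*\<^sup>* xs ys \<and> (\<nexists>i. mergeable N ys i)"

definition faom_lists :: "real \<Rightarrow> nat \<Rightarrow> nat \<Rightarrow> (nat \<Rightarrow> real list) \<Rightarrow> bool" where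
  "faom_lists T NT N I \<longleftrightarrow> I 1 = [] \<and>
     (\<forall>n \<in> {2..NT}. merge_loop N
        (grid_point T NT (n - 1) # grid_point T NT (n - 2) # I (n - 1))
        (grid_point T NT (n - 1) # I n))"

definition subintervals :: "real \<Rightarrow> real list \<Rightarrow> real set list" where
  "subintervals t xs = map (\<lambda>i. {(t # xs) ! i .. (t # xs) ! (i - 1)}) [1..<Suc (length xs)]"

text \<open>The values stored in the vector are irrelevant here, so its entry type is left open; only the
  fact that there is one entry per subinterval matters.\<close>

definition storage_vectors ::
    "real \<Rightarrow> nat \<Rightarrow> (nat \<Rightarrow> real list) \<Rightarrow> (nat \<Rightarrow> 'u list) \<Rightarrow> bool" where
  "storage_vectors T NT I U \<longleftrightarrow>
     (\<forall>n \<in> {1..NT}. length (U n) = length (subintervals (grid_point T NT (n - 1)) (I n)))"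

text \<open>The merging loop terminates, so the relational description of the lists is never void.\<close>

lemma merge_loop_exists:
  assumes "N \<ge> 2"
  shows "\<exists>ys. merge_loop N (t # xs) (t # ys)"
proof (induction "length xs" arbitrary: xs rule: less_induct)
  case less
  show ?case
  proof (cases "\<exists>i. mergeable N (t # xs) i")
    case False
    then show ?thesis unfolding merge_loop_def by blast
  next
    case True
    then obtain i where i: "mergeable N (t # xs) i" by blast
    obtain zs where zs: "merge_at N i (t # xs) = t # zs"
      using assms by (cases "i + N") (auto simp: merge_at_def)
    have "length (merge_at N i (t # xs)) < length (t # xs)"
      using assms i by (auto simp: merge_at_def mergeable_def)
    with zs have "length zs < length xs" by simp
    then obtain ys where ys: "merge_loop N (t # zs) (t # ys)" using less by blast
    have "merge_step N (t # xs) (t # zs)" using i zs unfolding merge_step_def by metis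
    with ys have "merge_loop N (t # xs) (t # ys)"
      unfolding merge_loop_def by (meson converse_rtranclp_into_rtranclp)
    then show ?thesis by blast
  qed
qed

lemma faom_lists_exists:
  assumes "N \<ge> 2"
  shows "\<exists>I. faom_lists T NT N I"
proof -
  define P where "P n xs ys \<longleftrightarrow> merge_loop N
      (grid_point T NT (n - 1) # grid_point T NT (n - 2) # xs) (grid_point T NT (n - 1) # ys)"
    for n xs ys
  define I where "I = rec_nat [] (\<lambda>k xs. if k = 0 then [] else SOME ys. P (Suc k) xs ys)"
  have "P n (I (n - 1)) (I n)" if "n \<ge> 2" for n
  proof -
    obtain k where k: "n = Suc k" "k \<noteq> 0"
      using \<open>n \<ge> 2\<close> by (metis One_nat_def Suc_le_D Suc_le_mono le_zero_eq numeral_2_eq_2 one_neq_zero)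
    have "\<exists>ys. P n (I k) ys" unfolding P_def by (rule merge_loop_exists[OF assms])
    then have "P n (I k) (SOME ys. P n (I k) ys)" by (rule someI_ex)
    then show ?thesis using k by (simp add: I_def)
  qed
  moreover have "I 1 = []" by (simp add: I_def)
  ultimately show ?thesis unfolding faom_lists_def P_def by auto
qed

end

theory Submission
  imports Defs "HOL-Analysis.Convex"
begin

text \<open>
  Measured in units of the step size, the lengths of the subintervals form a list of natural
  numbers, read from the current time backwards, whose sum is \<open>n - 1\<close>. A time step prepends a gap
  \<open>1\<close>, and a merge replaces \<open>2 * N - 1\<close> adjacent gaps \<open>g\<close> by \<open>N - 1\<close> gaps \<open>g\<close> followed by one
  gap \<open>N * g\<close>. This is a carry in a base-\<open>N\<close> counter whose digit at \<open>N ^ k\<close> is the number of gaps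
  of that length: when a digit reaches \<open>2 * N - 1\<close> it drops to \<open>N - 1\<close> and the next digit grows by
  one. Hence, once the loop has stopped, the gaps are powers of \<open>N\<close> in nondecreasing order, every digit
  is at most \<open>2 * N - 2\<close>, and every digit below the leading one is at least \<open>N - 1\<close>
  (\<open>faom_list_is_reduced\<close>). This holds whichever admissible index each pass selects, because
  during the loop at most one digit is ever equal to \<open>2 * N - 1\<close>
  (\<open>merge_preserves_invariant\<close>).

  The length of the list is thus the digit sum \<open>M\<close> of a redundant base-\<open>N\<close> representation of
  \<open>n - 1\<close>. As no digit exceeds \<open>2 * N - 2\<close>, a large digit sum forces high places to be occupied,
  which gives \<open>N powr (M / (2 * (N - 1))) \<le> 1 + (n - 1) / 2\<close> (\<open>powr_digit_sum_le\<close>). As no digit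
  below the leading one is smaller than \<open>N - 1\<close>, high places in turn force a large digit sum, which
  gives \<open>n \<le> N powr (1 + M / (N - 1))\<close> (\<open>digit_value_le_powr\<close>). Both inequalities are proved by
  stripping the lowest digit, and taking logarithms yields the two bounds.
\<close>

section \<open>Gap lists\<close>

text \<open>
  The working list that starts at time \<open>t\<close> and has the prescribed gaps. Since the gaps are integer
  multiples of \<open>h\<close>, the comparison of real differences in \<open>mergeable\<close> becomes a comparison of
  natural numbers.
\<close>

fun points :: "real \<Rightarrow> real \<Rightarrow> nat list \<Rightarrow> real list" where
  "points t h [] = [t]"
| "points t h (g # gs) = t # points (t - h * real g) h gs"

lemma length_points [simp]: "length (points t h gs) = Suc (length gs)"
  by (induction gs arbitrary: t) auto

lemma points_gap:
  "i < length gs \<Longrightarrow> points t h gs ! i - points t h gs ! Suc i = h * real (gs ! i)"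
proof (induction gs arbitrary: t i)
  case (Cons g gs)
  show ?case
  proof (cases i)
    case 0
    then show ?thesis by (cases gs) auto
  next
    case (Suc j)
    then show ?thesis using Cons by auto
  qed
qed simp

lemma points_append_Cons:
  "points t h (us @ v # vs) = points t h us @ points (t - h * real (sum_list us + v)) h vs"
  by (induction us arbitrary: t) (auto simp: algebra_simps)

lemma take_points:
  "k \<le> length gs \<Longrightarrow> take (Suc k) (points t h gs) = points t h (take k gs)"
proof (induction gs arbitrary: t k)
  case (Cons g gs)
  then show ?case by (cases k) auto
qed simp

lemma drop_points:
  "k \<le> length gs \<Longrightarrow>
    drop k (points t h gs) = points (t - h * real (sum_list (take k gs))) h (drop k gs)"
proof (induction gs arbitrary: t k)
  case (Cons g gs)
  then show ?case by (cases k) (auto simp: algebra_simps)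
qed simp

lemma mergeable_pointsI:
  assumes "N \<ge> 1"
  shows "mergeable N (points t h (us @ replicate (2 * N - 1) g @ vs)) (length us)"
proof -
  let ?gs = "us @ replicate (2 * N - 1) g @ vs"
  have "?gs ! (length us + j) = g" if "j < 2 * N - 1" for j
    using that by (simp add: nth_append)
  then have "points t h ?gs ! (length us + j) - points t h ?gs ! (length us + j + 1) = h * real g"
    if "j < 2 * N - 1" for j
    using that points_gap[of "length us + j" ?gs t h] by simp
  from this this[of 0] show ?thesis
    using assms unfolding mergeable_def by auto
qed

lemma mergeable_pointsE:
  assumes "h > 0" "N \<ge> 1" "mergeable N (points t h gs) i"
  obtains us g vs where "gs = us @ replicate (2 * N - 1) g @ vs" "length us = i"
proof -
  have len: "i + (2 * N - 1) \<le> length gs"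
    using assms by (auto simp: mergeable_def)
  have eq: "gs ! (i + j) = gs ! i" if "j < 2 * N - 1" for j
  proof -
    have "h * real (gs ! (i + j)) = h * real (gs ! i)"
      using assms(3) that len points_gap[of "i + j" gs t h] points_gap[of i gs t h]
      by (auto simp: mergeable_def)
    then show ?thesis using assms(1) by simp
  qed
  have "take (2 * N - 1) (drop i gs) = replicate (2 * N - 1) (gs ! i)"
    using len eq by (intro nth_equalityI) auto
  then have "gs = take i gs @ replicate (2 * N - 1) (gs ! i) @ drop (2 * N - 1) (drop i gs)"
    by (metis append_take_drop_id)
  then show ?thesis using that len by (metis add_leE length_take min.absorb2)
qed

lemma merge_gap_sum:
  fixes N g :: nat
  assumes "N \<ge> 1"
  shows "(N - 1) * g + N * g = (2 * N - 1) * g"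
proof -
  have "N - 1 + N = 2 * N - 1" using assms by simp
  then show ?thesis by (metis add_mult_distrib)
qed

text \<open>
  Of the \<open>2 * N - 1\<close> equal gaps only the last \<open>N\<close> are fused: the entries that survive up to index
  \<open>length us + N - 1\<close> still bound \<open>N - 1\<close> of them.
\<close>

lemma merge_at_points:
  assumes "N \<ge> 1"
  shows "merge_at N (length us) (points t h (us @ replicate (2 * N - 1) g @ vs)) =
    points t h (us @ replicate (N - 1) g @ (N * g) # vs)"
proof -
  let ?gs = "us @ replicate (2 * N - 1) g @ vs"
  have "take (Suc (length us + (N - 1))) (points t h ?gs) = points t h (us @ replicate (N - 1) g)"
    using assms by (subst take_points) auto
  moreover have "sum_list (take (length us + (2 * N - 1)) ?gs) =
      sum_list (us @ replicate (N - 1) g) + N * g"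
    using merge_gap_sum[OF assms, of g] by (simp add: sum_list_replicate)
  then have "drop (length us + (2 * N - 1)) (points t h ?gs) =
      points (t - h * real (sum_list (us @ replicate (N - 1) g) + N * g)) h vs"
    by (subst drop_points) (simp_all del: sum_list_append)
  ultimately show ?thesis
    using assms points_append_Cons[of t h "us @ replicate (N - 1) g" "N * g" vs]
    by (simp add: merge_at_def del: sum_list_append of_nat_add)
qed

section \<open>The invariant of the merging loop\<close>

text \<open>
  The third condition says that no digit below the leading one is smaller than \<open>N - 1\<close>; the leading
  digit is exempt, as it is \<open>1\<close> right after a carry has created it.
\<close>

definition graded :: "nat \<Rightarrow> nat list \<Rightarrow> bool" where
  "graded N gs \<longleftrightarrow> sorted gs \<and> (\<forall>g \<in> set gs. \<exists>k. g = N ^ k) \<and>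
     (\<forall>k. \<forall>g \<in> set gs. N ^ k < g \<longrightarrow> N - 1 \<le> count_list gs (N ^ k))"

definition reduced :: "nat \<Rightarrow> nat list \<Rightarrow> bool" where
  "reduced N gs \<longleftrightarrow> (\<forall>g. count_list gs g < 2 * N - 1)"

text \<open>
  The state between passes: \<open>a\<close> is the place that received the last increment, and hence the only
  one where a carry can be due.
\<close>

definition nearly_reduced :: "nat \<Rightarrow> nat list \<Rightarrow> bool" where
  "nearly_reduced N gs \<longleftrightarrow> (\<exists>a. count_list gs a \<le> 2 * N - 1 \<and>
     (\<forall>g. g \<noteq> a \<longrightarrow> count_list gs g < 2 * N - 1))"

lemma count_list_replicate: "count_list (replicate n a) b = (if a = b then n else 0)"
  by (induction n) auto

lemma sorted_split_at:
  fixes gs :: "nat list"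
  shows "sorted gs \<Longrightarrow> gs = filter (\<lambda>x. x < a) gs @ replicate (count_list gs a) a @ filter (\<lambda>x. a < x) gs"
proof (induction gs)
  case (Cons g gs)
  consider "g < a" | "g = a" | "a < g" by linarith
  then show ?case
  proof cases
    case 3
    have "count_list gs a = 0" "filter (\<lambda>x. x < a) gs = []" 
      using Cons.prems 3 by (auto simp: filter_empty_conv count_list_0_iff)
    then show ?thesis using Cons 3 by auto
  next
    case 2
    then have "filter (\<lambda>x. x < a) gs = []" 
      using Cons.prems by (auto simp: filter_empty_conv)
    then show ?thesis using Cons 2 by auto
  qed (use Cons in auto)
qed simp

text \<open>
  A carry out of \<open>g\<close> leaves the digit of \<open>g\<close> at \<open>N - 1\<close>, exactly the lower bound that this digit
  must satisfy now that the larger gap \<open>N * g\<close> is present, and passes the possible excess on to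
  \<open>N * g\<close>. The order survives because the merged run contains all gaps \<open>g\<close>, so that the gaps
  behind it, being larger powers of \<open>N\<close>, are at least \<open>N * g\<close>.
\<close>

lemma merge_preserves_invariant:
  assumes N: "N \<ge> 2"
    and gs: "gs = us @ replicate (2 * N - 1) g @ vs"
    and gr: "graded N gs" and nr: "nearly_reduced N gs"
  defines "gs' \<equiv> us @ replicate (N - 1) g @ (N * g) # vs"
  shows "graded N gs' \<and> nearly_reduced N gs' \<and> sum_list gs' = sum_list gs"
proof -
  have cnt: "count_list gs x = count_list us x + (if g = x then 2 * N - 1 else 0) + count_list vs x" for x
    unfolding gs by (simp add: count_list_replicate)
  obtain a where a: "count_list gs a \<le> 2 * N - 1" "\<And>x. x \<noteq> a \<Longrightarrow> count_list gs x < 2 * N - 1"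
    using nr by (auto simp: nearly_reduced_def)
  \<comment> \<open>The run exhausts the overfull digit, so no gap \<open>g\<close> lies outside it.\<close>
  have "g = a" using a(2)[of g] cnt[of g] by auto
  then have "count_list us g = 0" "count_list vs g = 0"
    using a(1) cnt[of g] by auto
  then have nin: "g \<notin> set us" "g \<notin> set vs"
    by (auto simp: count_list_0_iff)
  have gin: "g \<in> set gs" using N by (simp add: gs)
  then obtain j where j: "g = N ^ j" using gr by (auto simp: graded_def)
  have srt: "sorted us" "sorted vs" "\<And>x. x \<in> set us \<Longrightarrow> x < g" "\<And>x. x \<in> set vs \<Longrightarrow> g < x"
    "\<And>x y. x \<in> set us \<Longrightarrow> y \<in> set vs \<Longrightarrow> x \<le> y"
    using gr nin N by (auto simp: graded_def gs sorted_append order.order_iff_strict)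
  have powers: "\<exists>k. x = N ^ k" if "x \<in> set gs" for x
    using gr that by (simp add: graded_def)
  have above: "N * g \<le> x" if x: "x \<in> set vs" for x
  proof -
    obtain k where k: "x = N ^ k" using powers[of x] x unfolding gs by auto
    then have "j < k" using srt(4)[OF x] j N by simp
    then have "N ^ Suc j \<le> N ^ k" using N by (intro power_increasing) auto
    then show ?thesis using j k by simp
  qed
  have g0: "g > 0" using j N by simp
  have gNg: "g < N * g" using g0 N by simp
  have cnt': "count_list gs' x = count_list us x + (if g = x then N - 1 else 0) +
      (if N * g = x then 1 else 0) + count_list vs x" for x
    unfolding gs'_def by (simp add: count_list_replicate)
  have "sorted gs'"
    using srt gNg above by (auto simp: gs'_def sorted_append order_less_imp_le)
      (meson less_le_trans less_imp_le srt(3) gNg)+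
  moreover have "\<exists>k. x = N ^ k" if "x \<in> set gs'" for x
  proof (cases "x = N * g")
    case True
    then have "x = N ^ Suc j" using j by simp
    then show ?thesis ..
  next
    case False
    then have "x \<in> set gs" using that gin by (auto simp: gs'_def gs split: if_splits)
    then show ?thesis using gr by (auto simp: graded_def)
  qed
  moreover have "N - 1 \<le> count_list gs' (N ^ k)" if x: "x \<in> set gs'" "N ^ k < x" for k x
  proof (cases "N ^ k = g")
    case True
    then show ?thesis using cnt'[of "N ^ k"] by simp
  next
    case False
    \<comment> \<open>The place \<open>N ^ k\<close> was below the leading one before the merge as well: no power of \<open>N\<close> lies
        strictly between \<open>g\<close> and \<open>N * g\<close>.\<close>
    have "\<exists>y \<in> set gs. N ^ k < y"
    proof (cases "x = N * g")
      case True
      then have "N ^ k < N ^ Suc j" using x j by simp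
      then have "k < Suc j" using N by (simp only: power_strict_increasing_iff)
      then have "k < j" using False j by (cases "k = j") auto
      then have "N ^ k < g" using j N by simp
      then show ?thesis using gin by blast
    next
      case False
      then have "x \<in> set gs" using x gin by (auto simp: gs'_def gs split: if_splits)
      then show ?thesis using x by blast
    qed
    then have "N - 1 \<le> count_list gs (N ^ k)" using gr by (auto simp: graded_def)
    then show ?thesis using cnt[of "N ^ k"] cnt'[of "N ^ k"] False by auto
  qed
  ultimately have "graded N gs'" by (auto simp: graded_def)
  moreover have "nearly_reduced N gs'"
    unfolding nearly_reduced_def
  proof (intro exI[of _ "N * g"] conjI allI impI)
    show "count_list gs' (N * g) \<le> 2 * N - 1"
      using a(2)[of "N * g"] cnt[of "N * g"] cnt'[of "N * g"] \<open>g = a\<close> gNg by auto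
  next
    fix x assume "x \<noteq> N * g"
    then show "count_list gs' x < 2 * N - 1"
      using a(2)[of x] cnt[of x] cnt'[of x] \<open>g = a\<close> \<open>count_list us g = 0\<close> \<open>count_list vs g = 0\<close> N
      by (cases "x = g") auto
  qed
  moreover have "sum_list gs' = sum_list gs"
    using merge_gap_sum[of N g] N by (simp add: gs gs'_def sum_list_replicate)
  ultimately show ?thesis by blast
qed

lemma merge_steps_preserve_invariant:
  assumes "N \<ge> 2" "h > 0"
    and "(merge_step N)\<^sup>*\<^sup>* (points t h gs) ys" and "graded N gs" "nearly_reduced N gs"
  shows "\<exists>gs'. ys = points t h gs' \<and> graded N gs' \<and> nearly_reduced N gs' \<and>
    sum_list gs' = sum_list gs"
  using assms(3)
proof (induction rule: rtranclp_induct)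
  case base
  then show ?case using assms by blast
next
  case (step ys zs)
  then obtain gs' where gs': "ys = points t h gs'" "graded N gs'" "nearly_reduced N gs'"
    "sum_list gs' = sum_list gs" by blast
  obtain i where i: "mergeable N ys i" "zs = merge_at N i ys"
    using step.hyps(2) by (auto simp: merge_step_def)
  obtain us g vs where d: "gs' = us @ replicate (2 * N - 1) g @ vs" "length us = i"
    using mergeable_pointsE[of h N t gs' i] i(1) gs'(1) assms by auto
  have "zs = points t h (us @ replicate (N - 1) g @ (N * g) # vs)"
    using merge_at_points[of N us t h g vs] i(2) gs'(1) d assms by simp
  then show ?case
    using merge_preserves_invariant[OF assms(1) d(1) gs'(2,3)] gs'(4) by auto
qed

text \<open>In a sorted list equal gaps are adjacent, so a digit of at least \<open>2 * N - 1\<close> can be merged.\<close>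

lemma reduced_if_not_mergeable:
  assumes "N \<ge> 2" "sorted gs" "\<nexists>i. mergeable N (points t h gs) i"
  shows "reduced N gs"
  unfolding reduced_def
proof (rule allI, rule ccontr)
  fix a assume "\<not> count_list gs a < 2 * N - 1"
  then have "replicate (count_list gs a) a =
      replicate (2 * N - 1) a @ replicate (count_list gs a - (2 * N - 1)) a"
    by (simp flip: replicate_add)
  then obtain us vs where "gs = us @ replicate (2 * N - 1) a @ vs"
    using sorted_split_at[OF assms(2), of a] by (metis append.assoc)
  then show False using mergeable_pointsI[of N t h us a vs] assms by auto
qed

lemma nearly_reduced_Cons: "reduced N gs \<Longrightarrow> nearly_reduced N (g # gs)"
  unfolding reduced_def nearly_reduced_def
  by (intro exI[of _ g]) (auto simp: Suc_le_eq)

lemma graded_Cons_1: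
  assumes "N \<ge> 2" "graded N gs"
  shows "graded N (1 # gs)"
proof -
  have "1 \<le> g" if "g \<in> set gs" for g
    using assms that by (fastforce simp: graded_def)
  then have "sorted (1 # gs)" using assms(2) by (simp add: graded_def)
  moreover have "\<exists>k. g = N ^ k" if "g \<in> set (1 # gs)" for g
  proof (cases "g = 1")
    case True
    then show ?thesis by (intro exI[of _ 0]) simp
  next
    case False
    then show ?thesis using assms(2) that by (simp add: graded_def)
  qed
  moreover have "N - 1 \<le> count_list (1 # gs) (N ^ k)"
    if g: "g \<in> set (1 # gs)" "N ^ k < g" for k g
  proof -
    have "1 \<le> N ^ k" using assms(1) by simp
    then have "g \<in> set gs" using g by auto
    then have "N - 1 \<le> count_list gs (N ^ k)" using assms(2) g(2) by (auto simp: graded_def)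
    also have "\<dots> \<le> count_list (1 # gs) (N ^ k)" by simp
    finally show ?thesis .
  qed
  ultimately show ?thesis unfolding graded_def by blast
qed

lemma faom_list_is_reduced:
  assumes "T > 0" "N \<ge> 2" "faom_lists T NT N I" "1 \<le> n" "n \<le> NT"
  shows "\<exists>gs. grid_point T NT (n - 1) # I n = points (grid_point T NT (n - 1)) (T / real NT) gs \<and>
    graded N gs \<and> reduced N gs \<and> sum_list gs = n - 1"
  using assms(4,5)
proof (induction n rule: dec_induct)
  case base
  then show ?case using assms(2,3)
    by (intro exI[of _ "[]"]) (auto simp: faom_lists_def graded_def reduced_def)
next
  case (step n)
  let ?h = "T / real NT" and ?t = "grid_point T NT n"
  obtain gs where gs: "grid_point T NT (n - 1) # I n = points (grid_point T NT (n - 1)) ?h gs"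
    "graded N gs" "reduced N gs" "sum_list gs = n - 1"
    using step by auto
  have h: "?h > 0" using assms(1) step by simp
  have "?t - ?h = grid_point T NT (n - 1)"
    using step by (simp add: grid_point_def of_nat_diff left_diff_distrib diff_divide_distrib)
  then have start: "points ?t ?h (1 # gs) = ?t # grid_point T NT (n - 1) # I n"
    using gs(1) by simp
  have "Suc n \<in> {2..NT}" using step by auto
  then have "merge_loop N (points ?t ?h (1 # gs)) (?t # I (Suc n))"
    using assms(3) start unfolding faom_lists_def
    by (metis Suc_1 diff_Suc_1 diff_Suc_Suc)
  then have loop: "(merge_step N)\<^sup>*\<^sup>* (points ?t ?h (1 # gs)) (?t # I (Suc n))"
    "\<nexists>i. mergeable N (?t # I (Suc n)) i" by (auto simp: merge_loop_def)
  obtain gs' where gs': "?t # I (Suc n) = points ?t ?h gs'" "graded N gs'"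
      "sum_list gs' = sum_list (1 # gs)"
    using merge_steps_preserve_invariant[OF assms(2) h loop(1) graded_Cons_1[OF assms(2) gs(2)]
        nearly_reduced_Cons[OF gs(3)]] by blast
  have "reduced N gs'"
    using reduced_if_not_mergeable[of N gs' ?t ?h] gs' loop(2) assms(2) by (auto simp: graded_def)
  then show ?case using gs' gs(4) step by (intro exI[of _ gs']) auto
qed

section \<open>Digit sums of redundant base-N representations\<close>

text \<open>The convex function \<open>\<lambda>x. b powr x\<close> lies below its chord between \<open>0\<close> and \<open>1\<close>.\<close>

lemma powr_le_chord:
  fixes b x :: real
  assumes "b \<ge> 1" "0 \<le> x" "x \<le> 1"
  shows "b powr x \<le> 1 + (b - 1) * x"
proof -
  have "exp ((1 - x) *\<^sub>R 0 + x *\<^sub>R ln b) \<le> (1 - x) * exp 0 + x * exp (ln b)"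
    using assms(2,3) by (intro convex_onD[OF exp_convex]) auto
  moreover have "exp ((1 - x) *\<^sub>R 0 + x *\<^sub>R ln b) = b powr x"
    using assms(1) by (simp add: powr_def)
  moreover have "(1 - x) * exp 0 + x * exp (ln b) = 1 + (b - 1) * x"
    using assms(1) by (simp add: left_diff_distrib)
  ultimately show ?thesis by linarith
qed

text \<open>
  Equality holds when all digits are \<open>2 * (N - 1)\<close>: the value is then \<open>2 * (N ^ K - 1)\<close>. To strip
  the lowest digit, scale it to \<open>x = c 0 / (2 * (N - 1))\<close> in \<open>[0, 1]\<close> and let \<open>S\<close> be half the value
  of the remaining digits. The chord bound and the induction hypothesis leave
  \<open>(1 + (N - 1) * x) * (1 + S) \<le> 1 + (N - 1) * x + N * S\<close>, which holds since \<open>x \<le> 1\<close>.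
\<close>

lemma powr_digit_sum_le:
  fixes c :: "nat \<Rightarrow> nat"
  assumes "N \<ge> 2" "\<And>k. c k \<le> 2 * (N - 1)"
  shows "real N powr (real (\<Sum>k<K. c k) / (2 * (real N - 1))) \<le> 1 + real (\<Sum>k<K. c k * N ^ k) / 2"
  using assms(2)
proof (induction K arbitrary: c)
  case (Suc K)
  let ?S = "real (\<Sum>k<K. c (Suc k) * N ^ k) / 2" and ?m = "real (\<Sum>k<K. c (Suc k)) / (2 * (real N - 1))"
  define x where "x = real (c 0) / (2 * (real N - 1))"
  have N: "real N - 1 > 0" "real N \<ge> 1" using assms(1) by auto
  have "real (c 0) \<le> 2 * (real N - 1)"
    using of_nat_mono[OF Suc.prems[of 0], where 'a = real] assms(1) by (simp add: of_nat_diff)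
  then have x: "0 \<le> x" "x \<le> 1" using N by (auto simp: x_def)
  have c0: "real (c 0) / 2 = (real N - 1) * x" using N(1) by (simp add: x_def field_simps)
  have "real N powr (x + ?m) = real N powr x * real N powr ?m" by (simp add: powr_add)
  also have "\<dots> \<le> (1 + (real N - 1) * x) * (1 + ?S)"
    using powr_le_chord[OF N(2) x] Suc.IH[of "\<lambda>k. c (Suc k)"] Suc.prems N x
    by (intro mult_mono) auto
  also have "\<dots> = 1 + (real N - 1) * x + (1 + (real N - 1) * x) * ?S" by (simp add: algebra_simps)
  also have "\<dots> \<le> 1 + (real N - 1) * x + real N * ?S"
  proof -
    have "(real N - 1) * x \<le> (real N - 1) * 1" using N x by (intro mult_left_mono) auto
    then have "(1 + (real N - 1) * x) * ?S \<le> real N * ?S" by (intro mult_right_mono) (simp_all add: sum_nonneg)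
    then show ?thesis by simp
  qed
  also have "\<dots> = 1 + real (\<Sum>k<Suc K. c k * N ^ k) / 2"
    by (simp add: sum.lessThan_Suc_shift flip: c0 del: sum.lessThan_Suc)
       (simp add: sum_distrib_left mult_ac add_divide_distrib)
  also have "x + ?m = real (\<Sum>k<Suc K. c k) / (2 * (real N - 1))"
    by (simp add: sum.lessThan_Suc_shift x_def add_divide_distrib del: sum.lessThan_Suc)
  finally show ?case .
qed simp

text \<open>
  By \<open>1 + y \<le> exp y\<close> this comes down to \<open>N - 1 \<le> N * ln N\<close>, that is, to
  \<open>ln (1 / N) \<le> 1 / N - 1\<close>.
\<close>

lemma linear_le_powr:
  fixes N :: nat and d :: real
  assumes "N \<ge> 2"  "d \<ge> 0"
  shows "real N + d \<le> real N * real N powr (d / (real N - 1))"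
proof -
  have N: "real N > 1" using assms by simp
  have "ln (1 / real N) \<le> 1 / real N - 1" using N by (intro ln_le_minus_one) auto
  then have "real N - 1 \<le> real N * ln (real N)" using N by (simp add: ln_div field_simps)
  then have "d * (real N - 1) \<le> d * (real N * ln (real N))" using assms by (intro mult_left_mono)
  then have "real N + d \<le> real N * (1 + d / (real N - 1) * ln (real N))"
    using N by (simp add: field_simps)
  also have "\<dots> \<le> real N * exp (d / (real N - 1) * ln (real N))"
    using N by (intro mult_left_mono exp_ge_add_one_self) auto
  also have "\<dots> = real N * real N powr (d / (real N - 1))" using N by (simp add: powr_def)
  finally show ?thesis .
qed

text \<open>
  Write the lowest digit as \<open>N - 1 + d\<close>. Its mandatory part \<open>N - 1\<close> accounts for exactly one factor
  \<open>N\<close> on the right, which pays for the shift of the remaining digits by one place; the excess \<open>d\<close> is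
  absorbed by \<open>linear_le_powr\<close>. The leading digit, which may be small, is the base case: there the
  constant \<open>1\<close> in the exponent pays instead.
\<close>

lemma digit_value_le_powr:
  fixes c :: "nat \<Rightarrow> nat"
  assumes "N \<ge> 2" "\<And>k. k < K \<Longrightarrow> N - 1 \<le> c k"
  shows "1 + real (\<Sum>k\<le>K. c k * N ^ k) \<le> real N powr (1 + real (\<Sum>k\<le>K. c k) / (real N - 1))"
  using assms(2)
proof (induction K arbitrary: c)
  case 0
  then show ?case using linear_le_powr[of N "real (c 0)"] assms(1) by (simp add: powr_add)
next
  case (Suc K)
  let ?S = "real (\<Sum>k\<le>K. c (Suc k) * N ^ k)" and ?m = "real (\<Sum>k\<le>K. c (Suc k)) / (real N - 1)"
  have N: "real N > 1" using assms by simp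
  define d where "d = real (c 0) - (real N - 1)"
  have d: "d \<ge> 0" using Suc.prems[of 0] assms(1) by (simp add: d_def)
  have "1 + real (\<Sum>k\<le>Suc K. c k * N ^ k) = d + real N * (1 + ?S)"
    by (simp add: sum.atMost_Suc_shift d_def algebra_simps del: sum.atMost_Suc)
       (simp add: sum_distrib_left mult_ac)
  also have "\<dots> \<le> (real N + d) * (1 + ?S)"
  proof -
    have "0 \<le> d * ?S" using d by (intro mult_nonneg_nonneg of_nat_0_le_iff)
    then show ?thesis by (simp add: algebra_simps)
  qed
  also have "\<dots> \<le> (real N * real N powr (d / (real N - 1))) * real N powr (1 + ?m)"
    using linear_le_powr[OF assms(1) d] Suc.IH[of "\<lambda>k. c (Suc k)"] Suc.prems d
    by (intro mult_mono add_nonneg_nonneg of_nat_0_le_iff) auto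
  also have "\<dots> = real N powr (1 + (1 + d / (real N - 1) + ?m))"
    using N by (simp add: powr_add power2_eq_square)
  also have "1 + d / (real N - 1) + ?m = real (\<Sum>k\<le>Suc K. c k) / (real N - 1)"
  proof -
    have "1 + d / (real N - 1) = real (c 0) / (real N - 1)"
      using N by (simp add: d_def field_simps)
    then show ?thesis by (simp add: sum.atMost_Suc_shift add_divide_distrib del: sum.atMost_Suc)
  qed
  finally show ?case .
qed

section \<open>The number of subintervals\<close>

lemma graded_digits:
  assumes "N \<ge> 2" "graded N gs" "gs \<noteq> []"
  obtains K where "length gs = (\<Sum>k\<le>K. count_list gs (N ^ k))"
    "sum_list gs = (\<Sum>k\<le>K. count_list gs (N ^ k) * N ^ k)"
    "\<And>k. k < K \<Longrightarrow> N - 1 \<le> count_list gs (N ^ k)"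
proof -
  have "Max (set gs) \<in> set gs" using assms(3) by simp
  then obtain K where K: "Max (set gs) = N ^ K" using assms(2) by (auto simp: graded_def)
  then have Kin: "N ^ K \<in> set gs" using \<open>Max (set gs) \<in> set gs\<close> by simp
  have "set gs \<subseteq> (^) N ` {..K}"
  proof
    fix g assume g: "g \<in> set gs"
    then obtain k where k: "g = N ^ k" using assms(2) by (auto simp: graded_def)
    have "g \<le> N ^ K" using g K by (metis List.finite_set Max_ge)
    then have "k \<le> K" using k assms(1) by simp
    then show "g \<in> (^) N ` {..K}" using k by simp
  qed
  moreover have inj: "inj_on ((^) N) {..K}" using assms(1) by (auto intro: inj_onI)
  ultimately have sum: "sum_list (map f gs) = (\<Sum>k\<le>K. count_list gs (N ^ k) * f (N ^ k))" for f
    by (subst sum_list_map_eq_sum_count2[where X = "(^) N ` {..K}"]) (auto simp: sum.reindex)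
  show ?thesis
  proof
    show "length gs = (\<Sum>k\<le>K. count_list gs (N ^ k))"
      using sum[of "\<lambda>_. 1"] by (simp add: sum_list_triv)
    show "sum_list gs = (\<Sum>k\<le>K. count_list gs (N ^ k) * N ^ k)"
      using sum[of "\<lambda>x. x"] by simp
    show "N - 1 \<le> count_list gs (N ^ k)" if "k < K" for k
    proof -
      have "N ^ k < N ^ K" using that assms(1) by simp
      then show ?thesis using Kin assms(2) by (auto simp: graded_def)
    qed
  qed
qed

lemma reduced_length_bounds:
  assumes "N \<ge> 2" "graded N gs" "reduced N gs" "gs \<noteq> []"
  defines "s \<equiv> real (sum_list gs)"
  shows "(real N - 1) * (log (real N) (s + 1) - 1) \<le> real (length gs)"
    and "real (length gs) \<le> 2 * (real N - 1) * log (real N) ((s + 2) / 2)"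
proof -
  have N: "real N > 1" using assms by simp
  have s: "s \<ge> 0" by (simp add: s_def)
  obtain K where K: "length gs = (\<Sum>k\<le>K. count_list gs (N ^ k))"
    "sum_list gs = (\<Sum>k\<le>K. count_list gs (N ^ k) * N ^ k)"
    "\<And>k. k < K \<Longrightarrow> N - 1 \<le> count_list gs (N ^ k)"
    using graded_digits[OF assms(1,2,4)] by blast
  have "1 + s \<le> real N powr (1 + real (length gs) / (real N - 1))"
    using digit_value_le_powr[of N K "\<lambda>k. count_list gs (N ^ k)", OF assms(1) K(3)] K(1,2)
    by (simp add: s_def)
  then have "log (real N) (s + 1) \<le> 1 + real (length gs) / (real N - 1)"
    using N s by (simp add: log_le_iff add.commute)
  then show "(real N - 1) * (log (real N) (s + 1) - 1) \<le> real (length gs)"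
    using N by (simp add: field_simps)
  have digit: "count_list gs (N ^ k) \<le> 2 * (N - 1)" for k
  proof -
    have "count_list gs (N ^ k) < 2 * N - 1" using assms(3) by (simp add: reduced_def)
    then show ?thesis by linarith
  qed
  have "real N powr (real (length gs) / (2 * (real N - 1))) \<le> 1 + s / 2"
    using powr_digit_sum_le[of N "\<lambda>k. count_list gs (N ^ k)" "Suc K", OF assms(1) digit] K(1,2)
    by (simp add: s_def lessThan_Suc_atMost del: sum.lessThan_Suc)
  then have "real (length gs) / (2 * (real N - 1)) \<le> log (real N) (1 + s / 2)"
    using N s by (simp add: le_log_iff)
  moreover have half: "1 + s / 2 = (s + 2) / 2" by simp
  ultimately show "real (length gs) \<le> 2 * (real N - 1) * log (real N) ((s + 2) / 2)"
    unfolding half using N by (simp add: pos_divide_le_eq mult.commute)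
qed

theorem lemma2p2:
  fixes T :: real and NT N n :: nat
    and I :: "nat \<Rightarrow> real list" and U :: "nat \<Rightarrow> 'u list"
  assumes "T > 0" and "N \<ge> 2" and "2 \<le> n" and "n \<le> NT"
    and "faom_lists T NT N I"
    and "storage_vectors T NT I U"
  shows "(real N - 1) * (log (real N) (real n) - 1) \<le> real (length (U n)) \<and>
    real (length (U n)) \<le> 2 * (real N - 1) * log (real N) ((real n + 1) / 2)"
proof -
  obtain gs where gs: "grid_point T NT (n - 1) # I n =
      points (grid_point T NT (n - 1)) (T / real NT) gs"
    "graded N gs" "reduced N gs" "sum_list gs = n - 1"
    using faom_list_is_reduced[of T N NT I n] assms by auto
  have "length (I n) = length gs" using arg_cong[OF gs(1), of length] by simp
  then have len: "length (U n) = length gs"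
    using assms(3,4,6) by (auto simp: storage_vectors_def subintervals_def simp del: upt_Suc)
  have "gs \<noteq> []" using gs(4) assms(3) by auto
  have "real (sum_list gs) + 1 = real n" "real (sum_list gs) + 2 = real n + 1"
    using gs(4) assms(3) by (simp_all add: of_nat_diff)
  then show ?thesis
    using reduced_length_bounds[OF assms(2) gs(2,3) \<open>gs \<noteq> []\<close>] by (simp only: len)
qed

end
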